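(* For every integer $q>1$, \[ \sum_{n=1}^\infty\frac{n}{(n-1/2)^q}\cdot\frac{\binom{2n}{n}}{4^n}=\frac{2}{\pi}\sum_{\substack{k_1+\dots+k_4+2k_5=q-2\\k_1,\dots,k_5\ge0}}G(k_1,k_2,k_3,k_4)\,\widetilde t(2k_5+2). \]
   Context: Let $\zeta$ be the Riemann zeta function and, for $k>1$, $\widetilde t(k)=2^k\sum_{n\ge1}\frac{1}{(2n-1)^k}=(2^k-1)\zeta(k)$. The exponential complete Bell polynomials $Y_n$ are defined by $\exp\big(\sum_{k\ge1}x_k\frac{t^k}{k!}\big)=\sum_{n\ge0}Y_n(x_1,\dots,x_n)\frac{t^n}{n!}$. Set $C_n=Y_n(0,1!\zeta(2),-2!\zeta(3),\dots,(-1)^n(n-1)!\zeta(n))$ and $D_n=Y_n(0,-1!\zeta(2),2!\zeta(3),\dots,(-1)^{n-1}(n-1)!\zeta(n))$. Define $G(k_1,k_2,k_3,k_4)=\frac{2^{k_3+k_4}\log^{k_4}(2)\,C_{k_1}C_{k_2}D_{k_3}}{k_1!\,k_2!\,k_3!\,k_4!}$. *)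

theory Defs
  imports "HOL-Analysis.Analysis" "HOL-Computational_Algebra.Formal_Power_Series"
begin

text \<open>The Riemann zeta function on its real domain of convergence \<open>s > 1\<close>; only the values
  at integers at least 2 are ever used.\<close>

definition zeta :: "real \<Rightarrow> real" where
  "zeta s = (\<Sum>n. 1 / real (Suc n) powr s)"

text \<open>Meaningful for \<open>k > 1\<close>. The summation index is shifted by one.\<close>

definition t_tilde :: "real \<Rightarrow> real" where
  "t_tilde k = 2 powr k * (\<Sum>n. 1 / (2 * real (Suc n) - 1) powr k)"

text \<open>Exponential complete Bell polynomials, by their generating function
  \<open>exp (\<Sum>k\<ge>1. x\<^sub>k t^k / k!) = (\<Sum>n. Y\<^sub>n(x\<^sub>1,\<dots>,x\<^sub>n) t^n / n!)\<close> as formal power series. The argument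
  is a whole sequence \<open>x\<close>, but the value at \<open>n\<close> depends only on \<open>x 1, \<dots>, x n\<close>
  (\<open>complete_bell_cong\<close>).\<close>

definition complete_bell :: "nat \<Rightarrow> (nat \<Rightarrow> real) \<Rightarrow> real" where
  "complete_bell n x =
     fact n * fps_nth (fps_exp 1 oo Abs_fps (\<lambda>k. if k = 0 then 0 else x k / fact k)) n"

lemma complete_bell_cong:
  assumes "\<And>k. 1 \<le> k \<Longrightarrow> k \<le> n \<Longrightarrow> x k = y k"
  shows "complete_bell n x = complete_bell n y"
proof -
  let ?F = "\<lambda>x :: nat \<Rightarrow> real. Abs_fps (\<lambda>k. if k = 0 then 0 else x k / fact k)"
  have *: "fps_nth (?F x ^ i) m = fps_nth (?F y ^ i) m" if "m \<le> n" for i m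
    using that
  proof (induction i arbitrary: m)
    case (Suc i)
    show ?case
      unfolding power_Suc fps_mult_nth
      using Suc assms by (intro sum.cong refl arg_cong2[where f = "(*)"]) auto
  qed simp
  show ?thesis
    unfolding complete_bell_def fps_compose_nth using * by simp
qed

definition C_seq :: "nat \<Rightarrow> real" where
  "C_seq n = complete_bell n
     (\<lambda>k. if k = 1 then 0 else (-1) ^ k * fact (k - 1) * zeta (real k))"

definition D_seq :: "nat \<Rightarrow> real" where
  "D_seq n = complete_bell n
     (\<lambda>k. if k = 1 then 0 else (-1) ^ (k - 1) * fact (k - 1) * zeta (real k))"

definition G :: "nat \<Rightarrow> nat \<Rightarrow> nat \<Rightarrow> nat \<Rightarrow> real" where
  "G k1 k2 k3 k4 =
     2 ^ (k3 + k4) * ln 2 ^ k4 * C_seq k1 * C_seq k2 * D_seq k3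
       / (fact k1 * fact k2 * fact k3 * fact k4)"

definition indices :: "nat \<Rightarrow> (nat \<times> nat \<times> nat \<times> nat \<times> nat) set" where
  "indices m = {(k1, k2, k3, k4, k5). k1 + k2 + k3 + k4 + 2 * k5 = m}"

lemma finite_indices: "finite (indices m)"
proof (rule finite_subset)
  show "indices m \<subseteq> {..m} \<times> {..m} \<times> {..m} \<times> {..m} \<times> {..m}"
    by (auto simp: indices_def)
qed simp

end

theory Submission
  imports Defs "HOL-Complex_Analysis.Laurent_Convergence"
begin

text \<open>
  Both sides are compared through their generating functions in \<open>q - 2\<close>. With
  \<open>b\<^sub>m = (1/2)\<^sub>m / m!\<close> the summand on the left equals \<open>b\<^sub>m / (m + 1/2)^(q - 1)\<close> for \<open>m = n - 1\<close>, so its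
  generating function is \<open>\<Sum>\<^sub>m b\<^sub>m / (m + 1/2 - x)\<close>, which is \<open>B(1/2 - x, 1/2)\<close> by expanding
  \<open>(1 - t)^(-1/2)\<close> in the Beta integral. Reflection and duplication turn this into
  \<open>tan (\<pi> x) / x \<cdot> 4^x \<Gamma>(1 + x)\<^sup>2 / \<Gamma>(1 + 2 x)\<close>. On the right, the \<open>C\<^sub>k\<close> and \<open>D\<^sub>k\<close> are the exponential
  coefficients of \<open>\<Gamma>(1 + x) e^(\<gamma> x)\<close> and of its reciprocal, and
  \<open>\<pi> tan (\<pi> x) = \<psi>(1/2 + x) - \<psi>(1/2 - x)\<close> generates the numbers \<open>2 t~(2 k + 2)\<close>; the factors
  \<open>e^(\<gamma> x)\<close> cancel.
\<close>

unbundle no vec_syntax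

subsection \<open>Real and complex power series expansions\<close>

text \<open>The expansions of \<open>ln_Gamma\<close> and \<open>Digamma\<close> come from complex
  analyticity, while the Bell polynomials are real. The embedding lets a complex expansion with real
  coefficients be restricted to the real line.\<close>

definition fps_cplx :: "real fps \<Rightarrow> complex fps" where
  "fps_cplx F = Abs_fps (\<lambda>n. complex_of_real (F $ n))"

lemma fps_nth_fps_cplx [simp]: "fps_cplx F $ n = complex_of_real (F $ n)"
  by (simp add: fps_cplx_def)

lemma fps_cplx_mult: "fps_cplx (F * H) = fps_cplx F * fps_cplx H"
  by (rule fps_ext) (simp add: fps_mult_nth)

lemma fps_cplx_power: "fps_cplx (F ^ n) = fps_cplx F ^ n"
proof (induction n)
  case 0
  show ?case by (simp add: fps_eq_iff)
qed (simp add: fps_cplx_mult)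

lemma fps_cplx_compose: "fps_cplx (F oo H) = fps_cplx F oo fps_cplx H"
  by (rule fps_ext) (simp add: fps_compose_nth flip: fps_cplx_power)

lemma has_fps_expansion_imp_sums:
  fixes f :: "'a :: {banach, real_normed_field} \<Rightarrow> 'a"
  assumes "f has_fps_expansion F"
  shows   "eventually (\<lambda>u. (\<lambda>n. F $ n * u ^ n) sums f u) (nhds 0)"
proof -
  have "eventually (\<lambda>u. u \<in> eball 0 (fps_conv_radius F)) (nhds (0::'a))"
    using assms by (intro eventually_nhds_in_open) (auto simp: has_fps_expansion_def zero_ereal_def)
  moreover have "eventually (\<lambda>u. eval_fps F u = f u) (nhds 0)"
    using assms by (simp add: has_fps_expansion_def)
  ultimately show ?thesis
  proof eventually_elim
    case (elim u)
    then show ?case using sums_eval_fps[of u F] by (simp add: in_eball_iff)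
  qed
qed

lemma has_fps_expansion_unique:
  fixes f :: "'a :: {banach, real_normed_field} \<Rightarrow> 'a"
  assumes "f has_fps_expansion F" "f has_fps_expansion H"
  shows   "F = H"
proof (rule ccontr)
  assume "F \<noteq> H"
  then obtain m where m: "(F - H) $ m \<noteq> 0"
    by (auto simp: fps_eq_iff)
  have "(\<lambda>_. 0) has_fps_expansion F - H"
    using has_fps_expansion_diff[OF assms] by simp
  from has_fps_expansion_imp_sums[OF this] obtain r where r: "r > 0"
    "\<And>x. norm x < r \<Longrightarrow> (\<lambda>n. (F - H) $ n * x ^ n) sums 0"
    unfolding eventually_nhds_metric by auto
  have "(F - H) $ 0 = 0"
    using r(2)[of 0] \<open>r > 0\<close> by simp
  with m have "m > 0" by (cases m) auto
  \<comment> \<open>A nonzero power series has isolated zeros. The sum here is identically 0, so any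
    nonzero point of the ball gives the absurd \<open>0 \<noteq> 0\<close>.\<close>
  obtain s where s: "s > 0" "\<And>z. z \<in> cball (0::'a) s - {0} \<Longrightarrow> (0::'a) \<noteq> 0"
    using powser_0_nonzero[OF r(1), of 0 "fps_nth (F - H)" "\<lambda>_. 0", OF _ _ m \<open>m > 0\<close>] r(2)
    by auto
  from s(2)[of "of_real s"] s(1) show False by simp
qed

lemma has_fps_expansion_scale:
  fixes f :: "'a :: {banach, real_normed_field} \<Rightarrow> 'a"
  assumes "f has_fps_expansion F"
  shows   "(\<lambda>x. f (c * x)) has_fps_expansion Abs_fps (\<lambda>n. c ^ n * F $ n)"
proof (rule has_fps_expansionI)
  have "((\<lambda>x. c * x) \<longlongrightarrow> c * 0) (nhds 0)"
    by (intro tendsto_intros filterlim_ident)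
  hence "filterlim (\<lambda>x. c * x) (nhds 0) (nhds 0)" by simp
  from eventually_compose_filterlim[OF has_fps_expansion_imp_sums[OF assms] this]
  show "\<forall>\<^sub>F u in nhds 0. (\<lambda>n. Abs_fps (\<lambda>n. c ^ n * F $ n) $ n * u ^ n) sums f (c * u)"
    by eventually_elim (simp add: power_mult_distrib mult_ac)
qed

lemma has_fps_expansion_real_if_complex:
  assumes "g has_fps_expansion fps_cplx F"
  assumes "eventually (\<lambda>x. g (complex_of_real x) = of_real (f x)) (nhds 0)"
  shows   "f has_fps_expansion F"
proof (rule has_fps_expansionI)
  have "(complex_of_real \<longlongrightarrow> of_real 0) (nhds 0)"
    by (intro tendsto_intros filterlim_ident)
  hence "filterlim complex_of_real (nhds 0) (nhds 0)" by simp
  from eventually_compose_filterlim[OF has_fps_expansion_imp_sums[OF assms(1)] this] assms(2)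
  show "\<forall>\<^sub>F u in nhds 0. (\<lambda>n. F $ n * u ^ n) sums f u"
  proof eventually_elim
    case (elim u)
    from elim have "(\<lambda>n. complex_of_real (F $ n * u ^ n)) sums of_real (f u)" by simp
    thus ?case unfolding sums_of_real_iff .
  qed
qed

subsection \<open>Expansions of the Gamma and tangent functions\<close>

lemma zeta_sums:
  assumes "k > 1"
  shows "(\<lambda>n. 1 / real (Suc n) ^ k) sums zeta (real k)"
proof -
  have "summable (\<lambda>n. 1 / real n ^ k)" 
    using inverse_power_summable[of k, where 'a = real] assms by (simp add: field_simps)
  hence "summable (\<lambda>n. 1 / real (Suc n) ^ k)"
    by (subst summable_Suc_iff)
  thus ?thesis by (simp add: zeta_def sums_iff powr_realpow del: of_nat_Suc)
qed

text \<open>Absorbing the factor \<open>2 ^ k\<close> turns odd denominators into half-integers, the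
  shape of the series for \<open>Polygamma\<close> at 1/2.\<close>

lemma t_tilde_sums:
  assumes "k > 1"
  shows "(\<lambda>n. 1 / (real n + 1/2) ^ k) sums t_tilde (real k)"
proof -
  have "summable (\<lambda>n. 1 / (real n + 1/2) ^ k)"
  proof (rule summable_comparison_test')
    show "summable (\<lambda>n. 2 ^ k * (1 / real (Suc n) ^ k))"
      using zeta_sums[OF assms] by (intro summable_mult) (simp add: sums_iff)
    show "norm (1 / (real n + 1/2) ^ k) \<le> 2 ^ k * (1 / real (Suc n) ^ k)" for n
    proof -
      have "(real (Suc n) / 2) ^ k \<le> (real n + 1/2) ^ k"
        by (intro power_mono) auto
      moreover have "(real (Suc n) / 2) ^ k > 0" by simp
      ultimately have "1 / (real n + 1/2) ^ k \<le> 1 / (real (Suc n) / 2) ^ k"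
        by (intro divide_left_mono mult_pos_pos) (auto simp del: of_nat_Suc)
      thus ?thesis by (simp add: power_divide)
    qed
  qed
  hence "(\<lambda>n. 2 ^ k * (1 / (2 * real (Suc n) - 1) ^ k)) sums (2 ^ k * (\<Sum>n. 1 / (2 * real (Suc n) - 1) ^ k))"
  proof (intro sums_mult)
    assume *: "summable (\<lambda>n. 1 / (real n + 1/2) ^ k)"
    have "(\<lambda>n. 1 / (2 * real (Suc n) - 1) ^ k) = (\<lambda>n. (1 / 2 ^ k) * (1 / (real n + 1/2) ^ k))"
      by (auto simp: fun_eq_iff field_simps simp flip: power_mult_distrib)
    with * show "(\<lambda>n. 1 / (2 * real (Suc n) - 1) ^ k) sums (\<Sum>n. 1 / (2 * real (Suc n) - 1) ^ k)"
      by (metis summable_mult summable_sums)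
  qed
  also have "(\<lambda>n. 2 ^ k * (1 / (2 * real (Suc n) - 1) ^ k)) = (\<lambda>n. 1 / (real n + 1/2) ^ k)"
    by (auto simp: fun_eq_iff field_simps simp flip: power_mult_distrib)
  also have "2 ^ k * (\<Sum>n. 1 / (2 * real (Suc n) - 1) ^ k) = t_tilde (real k)"
    unfolding t_tilde_def by (simp add: powr_realpow)
  finally show ?thesis .
qed

text \<open>Taylor series of ln Gamma(1 + x) + gamma x at 0. The missing linear term corresponds to
  the first Bell argument being 0.\<close>

definition ln_Gamma_fps :: "real fps" where
  "ln_Gamma_fps = Abs_fps (\<lambda>k. if k \<le> 1 then 0 else (-1) ^ k * zeta (real k) / real k)"

lemma Polygamma_1_zeta:
  assumes "k > 0"
  shows "Polygamma k (1::complex) = of_real ((-1) ^ Suc k * fact k * zeta (real (Suc k)))"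
proof -
  have "(\<lambda>n. complex_of_real (1 / real (Suc n) ^ Suc k)) sums of_real (zeta (real (Suc k)))"
    unfolding sums_of_real_iff using assms by (intro zeta_sums) auto
  hence "(\<Sum>n. inverse ((1 + of_nat n :: complex) ^ Suc k)) = of_real (zeta (real (Suc k)))"
    by (simp add: sums_iff divide_simps)
  thus ?thesis using assms by (simp add: Polygamma_def del: power_Suc)
qed

lemma Polygamma_half_t_tilde:
  assumes "k > 0"
  shows "Polygamma k (1/2::complex) = of_real ((-1) ^ Suc k * fact k * t_tilde (real (Suc k)))"
proof -
  have "(\<lambda>n. complex_of_real (1 / (real n + 1/2) ^ Suc k)) sums of_real (t_tilde (real (Suc k)))"
    unfolding sums_of_real_iff using assms by (intro t_tilde_sums) auto
  hence "(\<Sum>n. inverse ((1/2 + of_nat n :: complex) ^ Suc k)) = of_real (t_tilde (real (Suc k)))"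
    by (simp add: sums_iff divide_simps add_ac)
  thus ?thesis using assms by (simp add: Polygamma_def del: power_Suc)
qed

text \<open>The Taylor coefficients of \<open>ln_Gamma\<close> at 1 are polygamma values. The linear
  one is Digamma(1) = -gamma, cancelled by the added term; the higher ones are zeta values.\<close>

lemma ln_Gamma_expansion:
  "(\<lambda>z. ln_Gamma (1 + z) + euler_mascheroni * z) has_fps_expansion fps_cplx ln_Gamma_fps"
proof -
  have "ln_Gamma analytic_on {1::complex}"
    by (intro analytic_intros) auto
  hence 1: "(\<lambda>z. ln_Gamma (1 + z)) has_fps_expansion fps_expansion ln_Gamma (1::complex)"
    by (rule analytic_at_imp_has_fps_expansion)
  have nth: "fps_expansion ln_Gamma (1::complex) $ n = (if n = 0 then 0 else Polygamma (n - 1) 1 / fact n)" for n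
    using ln_Gamma_complex_conv_fact[of 1] by (simp add: fps_expansion_def higher_deriv_ln_Gamma_complex)
  have "fps_expansion ln_Gamma 1 + fps_const euler_mascheroni * fps_X = fps_cplx ln_Gamma_fps"
  proof (rule fps_ext)
    fix n
    consider "n = 0" | "n = 1" | k where "n = Suc (Suc k)"
      by (metis One_nat_def old.nat.exhaust)
    thus "(fps_expansion ln_Gamma 1 + fps_const euler_mascheroni * fps_X) $ n = fps_cplx ln_Gamma_fps $ n"
    proof cases
      case 3
      have "fact (Suc k) / (fact (Suc (Suc k))) = (1 / of_nat (Suc (Suc k)) :: complex)"
        by (subst fact_Suc[of "Suc k"]) (simp add: field_simps del: of_nat_Suc fact_Suc)
      with 3 show ?thesis
        by (simp add: nth ln_Gamma_fps_def Polygamma_1_zeta field_simps del: of_nat_Suc fact_Suc)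
    qed (auto simp: nth ln_Gamma_fps_def)
  qed
  moreover have "(\<lambda>z. ln_Gamma (1 + z) + euler_mascheroni * z) has_fps_expansion 
       fps_expansion ln_Gamma (1::complex) + fps_const euler_mascheroni * fps_X"
    by (intro fps_expansion_intros 1)
  ultimately show ?thesis by simp
qed

text \<open>Series of Gamma(1 + x) e^(gamma x), not of Gamma alone; \<open>rGamma_fps\<close>
  belongs to its reciprocal.\<close>

definition Gamma_fps :: "real fps" where
  "Gamma_fps = fps_exp 1 oo ln_Gamma_fps"

definition rGamma_fps :: "real fps" where
  "rGamma_fps = fps_exp 1 oo (- ln_Gamma_fps)"

text \<open>Since (k-1)!/k! = 1/k, the series inside the exponential that defines the Bell
  polynomial is \<open>ln_Gamma_fps\<close>.\<close>

lemma fps_nth_Gamma_fps: "Gamma_fps $ n = C_seq n / fact n"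
proof -
  have "ln_Gamma_fps = Abs_fps (\<lambda>k. if k = 0 then 0
          else (if k = 1 then 0 else (-1) ^ k * fact (k - 1) * zeta (real k)) / fact k)"
    by (rule fps_ext) (simp add: ln_Gamma_fps_def fact_reduce)
  thus ?thesis by (simp add: C_seq_def complete_bell_def Gamma_fps_def del: One_nat_def)
qed

lemma fps_nth_rGamma_fps: "rGamma_fps $ n = D_seq n / fact n"
proof -
  have "- ln_Gamma_fps = Abs_fps (\<lambda>k. if k = 0 then 0
          else (if k = 1 then 0 else (-1) ^ (k - 1) * fact (k - 1) * zeta (real k)) / fact k)"
  proof (rule fps_ext)
    fix k
    consider "k = 0" | "k = 1" | j where "k = Suc (Suc j)"
      by (metis One_nat_def old.nat.exhaust)
    thus "(- ln_Gamma_fps) $ k = Abs_fps (\<lambda>k. if k = 0 then 0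
          else (if k = 1 then 0 else (-1) ^ (k - 1) * fact (k - 1) * zeta (real k)) / fact k) $ k"
      by cases (simp_all add: ln_Gamma_fps_def fact_reduce del: of_nat_Suc)
  qed
  thus ?thesis by (simp add: D_seq_def complete_bell_def rGamma_fps_def del: One_nat_def)
qed

lemma fps_cplx_exp: "fps_cplx (fps_exp 1) = fps_exp 1"
  by (rule fps_ext) simp

lemma Gamma_expansion:
  "(\<lambda>x::real. Gamma (1 + x) * exp (euler_mascheroni * x)) has_fps_expansion Gamma_fps"
proof (rule has_fps_expansion_real_if_complex)
  have "(exp \<circ> (\<lambda>z. ln_Gamma (1 + z) + euler_mascheroni * z)) has_fps_expansion 
           (fps_exp 1 oo fps_cplx ln_Gamma_fps :: complex fps)"
    by (intro has_fps_expansion_compose fps_expansion_intros ln_Gamma_expansion)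
       (simp add: ln_Gamma_fps_def)
  thus "(exp \<circ> (\<lambda>z. ln_Gamma (1 + z) + euler_mascheroni * z)) has_fps_expansion fps_cplx Gamma_fps"
    by (simp add: Gamma_fps_def fps_cplx_compose fps_cplx_exp)
  \<comment> \<open>For x > -1 the argument 1 + x is positive, so the complex
    \<open>ln_Gamma\<close> agrees with the real one.\<close>
  have "eventually (\<lambda>x. x \<in> {-1<..}) (nhds (0::real))"
    by (intro eventually_nhds_in_open) auto
  thus "eventually (\<lambda>x. (exp \<circ> (\<lambda>z. ln_Gamma (1 + z) + euler_mascheroni * z)) (complex_of_real x) 
          = of_real (Gamma (1 + x) * exp (euler_mascheroni * x))) (nhds 0)"
  proof eventually_elim
    case (elim x)
    have "ln_Gamma (1 + complex_of_real x) = of_real (ln_Gamma (1 + x))"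
      using ln_Gamma_complex_of_real[of "1 + x"] elim by simp
    thus ?case using elim
      by (simp add: Gamma_real_pos_exp exp_add flip: exp_of_real)
  qed
qed

lemma rGamma_expansion:
  "(\<lambda>x::real. 1 / (Gamma (1 + x) * exp (euler_mascheroni * x))) has_fps_expansion rGamma_fps"
proof (rule has_fps_expansion_real_if_complex)
  have "(exp \<circ> (\<lambda>z. - (ln_Gamma (1 + z) + euler_mascheroni * z))) has_fps_expansion 
           (fps_exp 1 oo - fps_cplx ln_Gamma_fps :: complex fps)"
    by (intro has_fps_expansion_compose fps_expansion_intros ln_Gamma_expansion)
       (simp add: ln_Gamma_fps_def)
  moreover have "- fps_cplx ln_Gamma_fps = fps_cplx (- ln_Gamma_fps)"
    by (rule fps_ext) simp
  ultimately show "(exp \<circ> (\<lambda>z. - (ln_Gamma (1 + z) + euler_mascheroni * z))) has_fps_expansion fps_cplx rGamma_fps"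
    by (simp add: rGamma_fps_def fps_cplx_compose fps_cplx_exp)
  have "eventually (\<lambda>x. x \<in> {-1<..}) (nhds (0::real))"
    by (intro eventually_nhds_in_open) auto
  thus "eventually (\<lambda>x. (exp \<circ> (\<lambda>z. - (ln_Gamma (1 + z) + euler_mascheroni * z))) (complex_of_real x) 
          = of_real (1 / (Gamma (1 + x) * exp (euler_mascheroni * x)))) (nhds 0)"
  proof eventually_elim
    case (elim x)
    have "ln_Gamma (1 + complex_of_real x) = of_real (ln_Gamma (1 + x))"
      using ln_Gamma_complex_of_real[of "1 + x"] elim by simp
    thus ?case using elim
      by (simp add: Gamma_real_pos_exp exp_add exp_minus exp_diff field_simps flip: exp_of_real)
  qed
qed

text \<open>Series of pi tan(pi x) / (2 x), with the removable singularity at 0 filled in.\<close>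

definition t_tilde_fps :: "real fps" where
  "t_tilde_fps = Abs_fps (\<lambda>n. if even n then t_tilde (real (n + 2)) else 0)"

section \<open>The tangent through the reflection formula and Digamma near 1/2\<close>

lemma half_plus_notin_nonpos_Ints:
  assumes "norm w < 1/2"
  shows   "1/2 + w \<notin> (\<int>\<^sub>\<le>\<^sub>0 :: complex set)"
proof
  assume "1/2 + w \<in> \<int>\<^sub>\<le>\<^sub>0"
  then obtain n where "1/2 + w = - of_nat n" by (auto elim!: nonpos_Ints_cases')
  hence "Re (1/2 + w) \<le> 0" by simp
  with assms show False using abs_Re_le_cmod[of w] by simp
qed

text \<open>Reflection at 1/2 + w, where sin(pi (1/2 + w)) = cos(pi w). The division-free form can
  be differentiated and shows that no factor vanishes.\<close>

lemma Gamma_half_reflection: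
  assumes "norm w < 1/2"
  shows   "Gamma (1/2 + w) * Gamma (1/2 - w) * cos (of_real pi * w) = (of_real pi :: complex)"
proof -
  have "sin (of_real pi * (1/2 + w)) = cos (of_real pi * w)"
    by (simp add: sin_cos_eq ring_distribs)
  moreover have "rGamma (1/2 + w) * rGamma (1/2 - w) = sin (of_real pi * (1/2 + w)) / of_real pi"
    using rGamma_reflection_complex[of "1/2 + w"] by (simp add: algebra_simps)
  moreover have "Gamma (1/2 + w) \<noteq> 0" "Gamma (1/2 - w) \<noteq> 0"
    using half_plus_notin_nonpos_Ints[of w] half_plus_notin_nonpos_Ints[of "-w"] assms
    by (auto simp: Gamma_eq_zero_iff)
  ultimately show ?thesis by (simp add: rGamma_inverse_Gamma field_simps)
qed

lemma Digamma_diff_eq_tan: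
  assumes "norm z < 1/2"
  shows   "Digamma (1/2 + z) - Digamma (1/2 - z) = of_real pi * tan (of_real pi * z :: complex)"
proof -
  \<comment> \<open>The product-rule derivative of the left side of the reflection identity; it is 0
    because that product is constant near \<open>z\<close>.\<close>
  define D where "D = Gamma (1/2 + z) * Gamma (1/2 - z) *
    ((Digamma (1/2 + z) - Digamma (1/2 - z)) * cos (of_real pi * z) - of_real pi * sin (of_real pi * z))"
  have "((\<lambda>w. Gamma (1/2 + w) * Gamma (1/2 - w) * cos (of_real pi * w)) has_field_derivative D) (at z)"
    unfolding D_def using half_plus_notin_nonpos_Ints[of z] half_plus_notin_nonpos_Ints[of "-z"] assms
    by (auto intro!: derivative_eq_intros simp: algebra_simps)
  moreover have "((\<lambda>w. Gamma (1/2 + w) * Gamma (1/2 - w) * cos (of_real pi * w)) has_field_derivative 0) (at z)"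
  proof (rule has_field_derivative_transform_within_open)
    show "((\<lambda>_. of_real pi) has_field_derivative 0) (at z)" by simp
    show "z \<in> ball 0 (1/2)" using assms by simp
  qed (use Gamma_half_reflection in auto)
  ultimately have "D = 0" by (rule DERIV_unique)
  moreover have "Gamma (1/2 + z) * Gamma (1/2 - z) * cos (of_real pi * z) \<noteq> 0"
    using Gamma_half_reflection[OF assms] by simp
  ultimately have "(Digamma (1/2 + z) - Digamma (1/2 - z)) * cos (of_real pi * z) - of_real pi * sin (of_real pi * z) = 0"
    and "cos (of_real pi * z) \<noteq> 0"
    unfolding D_def mult_eq_0_iff by blast+
  thus ?thesis by (simp add: tan_def eq_divide_eq)
qed

text \<open>The tangent is the odd part of Digamma around 1/2: subtracting the reflected series
  removes the even coefficients and doubles the odd ones, hence the factor 1/2. At odd index n the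
  sign (-1)^(n+1) is 1, leaving t~(n+1).\<close>

lemma tan_expansion:
  "(\<lambda>x. pi * tan (pi * x) / 2) has_fps_expansion fps_X * t_tilde_fps"
proof (rule has_fps_expansion_real_if_complex)
  define P where "P = fps_expansion Digamma (1/2 :: complex)"
  have ana: "Digamma analytic_on {1/2 :: complex}"
    by (intro analytic_intros) auto
  have 1: "(\<lambda>z. Digamma (1/2 + z)) has_fps_expansion P"
    unfolding P_def by (rule analytic_at_imp_has_fps_expansion[OF ana])
  from has_fps_expansion_scale[OF this, of "-1"]
  have 2: "(\<lambda>z. Digamma (1/2 - z)) has_fps_expansion Abs_fps (\<lambda>n. (-1) ^ n * P $ n)"
    by simp
  have nth: "P $ n = Polygamma n (1/2) / fact n" for n
    using half_plus_notin_nonpos_Ints[of 0] by (simp add: P_def fps_expansion_def higher_deriv_Polygamma)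
  have "(\<lambda>z. (1/2) * (Digamma (1/2 + z) - Digamma (1/2 - z))) has_fps_expansion
            fps_const (1/2) * (P - Abs_fps (\<lambda>n. (-1) ^ n * P $ n))"
    by (intro fps_expansion_intros 1 2)
  also have "fps_const (1/2) * (P - Abs_fps (\<lambda>n. (-1) ^ n * P $ n)) = fps_cplx (fps_X * t_tilde_fps)"
  proof (rule fps_ext)
    fix n show "(fps_const (1/2) * (P - Abs_fps (\<lambda>n. (-1) ^ n * P $ n))) $ n = fps_cplx (fps_X * t_tilde_fps) $ n"
    proof (cases n)
      case (Suc k)
      thus ?thesis
        by (auto simp: nth Polygamma_half_t_tilde t_tilde_fps_def add_ac simp del: fact_Suc)
    qed auto
  qed
  finally show "(\<lambda>z. (1/2) * (Digamma (1/2 + z) - Digamma (1/2 - z))) has_fps_expansion fps_cplx (fps_X * t_tilde_fps)" .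
  have "eventually (\<lambda>x. x \<in> ball 0 (1/2)) (nhds (0::real))"
    by (intro eventually_nhds_in_open) auto
  thus "\<forall>\<^sub>F x in nhds 0. (1/2) * (Digamma (1/2 + complex_of_real x) - Digamma (1/2 - complex_of_real x)) =
          complex_of_real (pi * tan (pi * x) / 2)"
    by eventually_elim (subst Digamma_diff_eq_tan, auto simp: tan_of_real)
qed

subsection \<open>The Beta integral as a series\<close>

text \<open>The central binomial weight binom(2m, m) / 4^m, also the coefficient of t^m in (1 -
  t)^(-1/2).\<close>

definition half_binom :: "nat \<Rightarrow> real" where
  "half_binom m = pochhammer (1/2) m / fact m"

lemma half_binom_nonneg: "half_binom m \<ge> 0"
  unfolding half_binom_def by (intro divide_nonneg_pos pochhammer_nonneg) auto

lemma half_binom_power_series: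
  assumes "\<bar>t\<bar> < 1"
  shows   "(\<lambda>m. half_binom m * t ^ m) sums (1 - t) powr (-1/2)"
proof -
  have "(\<lambda>m. ((-1/2) gchoose m) * (-t) ^ m) sums (1 + (-t)) powr (-1/2)"
    using assms by (intro gen_binomial_real) auto
  also have "(\<lambda>m. ((-1/2) gchoose m) * (-t) ^ m) = (\<lambda>m. half_binom m * t ^ m)"
  proof
    fix m
    have "(-t) ^ m = (-1) ^ m * t ^ m" by (rule power_minus)
    moreover have "(-1) ^ m * (-1) ^ m = (1::real)" by (simp flip: power_add mult_2)
    ultimately show "((-1/2) gchoose m) * (-t) ^ m = half_binom m * t ^ m"
      by (simp add: gbinomial_pochhammer half_binom_def)
  qed
  finally show ?thesis by simp
qed

text \<open>Monotone convergence for the integral of t^(a-1) (1 - t)^(-1/2), with the binomial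
  series integrated term by term. The interval is open because the series diverges at t = 1.\<close>

lemma Beta_half_sums:
  fixes a :: real
  assumes a: "a > 0"
  shows "(\<lambda>m. half_binom m / (real m + a)) sums Beta a (1/2)"
proof -
  define f where "f = (\<lambda>k (t::real). \<Sum>m<k. half_binom m * t powr (real m + a - 1))"
  define g where "g = (\<lambda>t::real. t powr (a - 1) * (1 - t) powr (1/2 - 1))"
  have g: "(g has_integral Beta a (1/2)) {0<..<1}"
    using has_integral_Beta_real[of a "1/2"] a unfolding g_def
    by (simp only: has_integral_Icc_iff_Ioo)
  have f: "(f k has_integral (\<Sum>m<k. half_binom m / (real m + a))) {0<..<1}" for k
    unfolding f_def
  proof (intro has_integral_sum)
    fix m
    have "((\<lambda>t. t powr (real m + a - 1)) has_integral (1 / (real m + a))) {0..1}"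
      using has_integral_powr_from_0[of "real m + a - 1" 1] a by simp
    from has_integral_mult_right[OF this, of "half_binom m"]
    show "((\<lambda>t. half_binom m * t powr (real m + a - 1)) has_integral half_binom m / (real m + a)) {0<..<1}"
      by (simp add: has_integral_Icc_iff_Ioo)
  qed auto
  have mono: "f k t \<le> f (Suc k) t" for k t
    by (simp add: f_def half_binom_nonneg)
  have lim: "(\<lambda>k. f k t) \<longlonglongrightarrow> g t" if "t \<in> {0<..<1}" for t
  proof -
    have "(\<lambda>m. t powr (a - 1) * (half_binom m * t ^ m)) sums g t"
      unfolding g_def using half_binom_power_series[of t] that by (intro sums_mult) auto
    also have "(\<lambda>m. t powr (a - 1) * (half_binom m * t ^ m)) = (\<lambda>m. half_binom m * t powr (real m + a - 1))"
      using that by (auto simp: fun_eq_iff powr_add powr_diff powr_realpow)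
    finally show ?thesis by (simp add: sums_def f_def)
  qed
  have le: "f k t \<le> g t" if "t \<in> {0<..<1}" for k t
    using incseq_le[OF incseq_SucI[of "\<lambda>k. f k t"] lim[OF that]] mono by blast
  have bdd: "bounded (range (\<lambda>k. integral {0<..<1} (f k)))"
    unfolding bounded_iff
  proof (intro exI ballI, safe)
    fix k
    have "integral {0<..<1} (f k) = (\<Sum>m<k. half_binom m / (real m + a))"
      using f by (rule integral_unique)
    moreover have "(\<Sum>m<k. half_binom m / (real m + a)) \<le> Beta a (1/2)"
      by (rule has_integral_le[OF f g le])
    moreover have "(\<Sum>m<k. half_binom m / (real m + a)) \<ge> 0"
      using a by (intro sum_nonneg divide_nonneg_pos) (auto simp: half_binom_nonneg)
    ultimately show "norm (integral {0<..<1} (f k)) \<le> Beta a (1/2)" by simp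
  qed
  have "(\<lambda>k. integral {0<..<1} (f k)) \<longlonglongrightarrow> integral {0<..<1} g"
    using monotone_convergence_increasing[of f "{0<..<1}" g] f mono lim bdd
    by (auto simp: integrable_on_def)
  thus ?thesis
    using integral_unique[OF f] integral_unique[OF g] by (simp add: sums_def)
qed

section \<open>Generating function of the left-hand sums\<close>

lemma half_binom_summable: "summable (\<lambda>m. half_binom m / (real m + 1/2) ^ Suc j)"
proof (rule summable_comparison_test')
  show "summable (\<lambda>m. 2 ^ j * (half_binom m / (real m + 1/2)))"
    using Beta_half_sums[of "1/2"] by (intro summable_mult) (simp add: sums_iff)
  \<comment> \<open>Each of the j extra factors 1/(m + 1/2) is at most 2, which reduces to the Beta
    series at a = 1/2.\<close>
  show "norm (half_binom m / (real m + 1/2) ^ Suc j) \<le> 2 ^ j * (half_binom m / (real m + 1/2))" for m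
  proof -
    have "(1 / (real m + 1/2)) ^ j \<le> 2 ^ j"
      by (intro power_mono) (auto simp: field_simps)
    hence "(1 / (real m + 1/2)) ^ j * (half_binom m / (real m + 1/2)) \<le> 2 ^ j * (half_binom m / (real m + 1/2))"
      by (intro mult_right_mono divide_nonneg_pos half_binom_nonneg) auto
    moreover have "half_binom m / (real m + 1/2) ^ Suc j = (1 / (real m + 1/2)) ^ j * (half_binom m / (real m + 1/2))"
      by (simp add: power_divide)
    ultimately show ?thesis
      using half_binom_nonneg[of m] by (simp add: abs_mult)
  qed
qed

text \<open>The coefficient at \<open>q - 2\<close> is the left-hand sum of the theorem.\<close>

definition binom_fps :: "real fps" where
  "binom_fps = Abs_fps (\<lambda>j. \<Sum>m. half_binom m / (real m + 1/2) ^ Suc j)"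

lemma half_binom_geometric:
  fixes x :: real
  assumes "\<bar>x\<bar> < 1/2"
  shows "((\<lambda>j. half_binom m / (real m + 1/2) ^ Suc j * x ^ j) has_sum (half_binom m / (real m + (1/2 - x)))) UNIV"
proof -
  define y where "y = x / (real m + 1/2)"
  have y: "\<bar>y\<bar> < 1" using assms by (simp add: y_def field_simps)
  have "((\<lambda>j. y ^ j) has_sum (1 / (1 - y))) UNIV"
    using y by (intro norm_summable_imp_has_sum geometric_sums) (auto simp: summable_geometric power_abs)
  from has_sum_cmult_right[OF this, of "half_binom m / (real m + 1/2)"]
  have "((\<lambda>j. half_binom m / (real m + 1/2) * y ^ j) has_sum (half_binom m / (real m + 1/2) * (1 / (1 - y)))) UNIV" .
  also have "half_binom m / (real m + 1/2) * (1 / (1 - y)) = half_binom m / ((real m + 1/2) * (1 - y))" by simp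
  also have "(real m + 1/2) * (1 - y) = real m + (1/2 - x)"
    by (simp add: y_def field_simps)
  also have "(\<lambda>j. half_binom m / (real m + 1/2) * y ^ j) = (\<lambda>j. half_binom m / (real m + 1/2) ^ Suc j * x ^ j)"
    by (simp add: fun_eq_iff y_def power_divide)
  finally show ?thesis .
qed

text \<open>Expanding 1/(m + 1/2 - x) geometrically makes the Beta series a double series. Absolute
  summability follows from the nonnegative case with |x| for x, whose iterated sum is again a finite
  Beta value.\<close>

lemma half_binom_has_sum:
  fixes x :: real
  assumes "\<bar>x\<bar> < 1/2"
  shows "((\<lambda>(m,j). half_binom m / (real m + 1/2) ^ Suc j * x ^ j) has_sum Beta (1/2 - x) (1/2)) (UNIV \<times> UNIV)"
proof -
  have outer: "((\<lambda>m. half_binom m / (real m + (1/2 - y))) has_sum Beta (1/2 - y) (1/2)) UNIV" 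
    if "\<bar>y\<bar> < 1/2" for y
  proof (rule norm_summable_imp_has_sum)
    show sums: "(\<lambda>m. half_binom m / (real m + (1/2 - y))) sums Beta (1/2 - y) (1/2)"
      using that by (intro Beta_half_sums) auto
    have "norm (half_binom m / (real m + (1/2 - y))) = half_binom m / (real m + (1/2 - y))" for m
      using half_binom_nonneg[of m] that by simp
    thus "summable (\<lambda>m. norm (half_binom m / (real m + (1/2 - y))))"
      using sums by (simp only: sums_iff)
  qed
  have "(\<lambda>(m,j). half_binom m / (real m + 1/2) ^ Suc j * \<bar>x\<bar> ^ j) summable_on UNIV \<times> UNIV"
  proof (rule summable_on_SigmaI)
    show "((\<lambda>j. case (m, j) of (m, j) \<Rightarrow> half_binom m / (real m + 1/2) ^ Suc j * \<bar>x\<bar> ^ j) 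
             has_sum half_binom m / (real m + (1/2 - \<bar>x\<bar>))) UNIV" for m
      using half_binom_geometric[of "\<bar>x\<bar>" m] assms by simp
    show "(\<lambda>m. half_binom m / (real m + (1/2 - \<bar>x\<bar>))) summable_on UNIV"
      using outer[of "\<bar>x\<bar>"] assms by (auto simp: summable_on_def)
  qed (auto simp: half_binom_nonneg)
  moreover have "half_binom m / (real m + 1/2) ^ Suc j * \<bar>x\<bar> ^ j = norm (half_binom m / (real m + 1/2) ^ Suc j * x ^ j)" for m j
    by (simp add: half_binom_nonneg abs_mult power_abs)
  ultimately have "(\<lambda>p. norm ((\<lambda>(m,j). half_binom m / (real m + 1/2) ^ Suc j * x ^ j) p)) summable_on UNIV \<times> UNIV"
    by (simp only: case_prod_unfold)
  hence summable: "(\<lambda>(m,j). half_binom m / (real m + 1/2) ^ Suc j * x ^ j) summable_on UNIV \<times> UNIV"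
    by (rule abs_summable_summable)
  show ?thesis
  proof (rule has_sum_SigmaI[OF _ outer[OF assms] summable])
    show "((\<lambda>j. case (m, j) of (m, j) \<Rightarrow> half_binom m / (real m + 1/2) ^ Suc j * x ^ j) 
             has_sum half_binom m / (real m + (1/2 - x))) UNIV" for m
      using half_binom_geometric[OF assms, of m] by (simp only: prod.case)
  qed
qed

lemma binom_expansion:
  "(\<lambda>x::real. Beta (1/2 - x) (1/2)) has_fps_expansion binom_fps"
proof (rule has_fps_expansionI)
  have "eventually (\<lambda>x. x \<in> ball 0 (1/2)) (nhds (0::real))"
    by (intro eventually_nhds_in_open) auto
  thus "\<forall>\<^sub>F x in nhds 0. (\<lambda>j. binom_fps $ j * x ^ j) sums Beta (1/2 - x) (1/2)"
  proof eventually_elim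
    case (elim x)
    hence x: "\<bar>x\<bar> < 1/2" by simp
    \<comment> \<open>Summing over m first, instead of over j, collects the coefficient of each
      power of x.\<close>
    have "((\<lambda>(j,m). half_binom m / (real m + 1/2) ^ Suc j * x ^ j) has_sum Beta (1/2 - x) (1/2)) (UNIV \<times> UNIV)"
      using half_binom_has_sum[OF x] by (subst has_sum_swap) simp
    moreover have "((\<lambda>m. case (j,m) of (j,m) \<Rightarrow> half_binom m / (real m + 1/2) ^ Suc j * x ^ j) has_sum binom_fps $ j * x ^ j) UNIV" for j
    proof -
      have "((\<lambda>m. half_binom m / (real m + 1/2) ^ Suc j) has_sum binom_fps $ j) UNIV"
        using half_binom_summable[of j]
        by (intro norm_summable_imp_has_sum) (auto simp: binom_fps_def half_binom_nonneg summable_sums)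
      from has_sum_cmult_left[OF this, of "x ^ j"] show ?thesis by simp
    qed
    ultimately have "((\<lambda>j. binom_fps $ j * x ^ j) has_sum Beta (1/2 - x) (1/2)) UNIV"
      by (rule has_sum_SigmaD)
    thus ?case by (rule has_sum_imp_sums)
  qed
qed

subsection \<open>Comparison of coefficients\<close>

text \<open>Multiplication by x keeps the identity meaningful at x = 0. Three facts combine:
  reflection at 1/2 + x (\<open>ab\<close>), reflection at x (\<open>c\<close>) and duplication at
  1/2 + x (\<open>bc\<close>).\<close>

lemma Beta_half_eq_tan:
  fixes x :: real
  assumes x: "\<bar>x\<bar> < 1/2"
  shows "x * Beta (1/2 - x) (1/2) = tan (pi * x) * (Gamma (1 + x))\<^sup>2 * exp (2 * ln 2 * x) / Gamma (1 + 2 * x)"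
proof -
  define a b c d where "a = Gamma (1/2 - x)" and "b = Gamma (1/2 + x)" and "c = Gamma (1 + x)"
    and "d = Gamma (1 + 2 * x)"
  have pos: "a > 0" "b > 0" "c > 0" "d > 0"
    using x by (auto simp: a_def b_def c_def d_def intro!: Gamma_real_pos)
  have ab: "a * b * cos (pi * x) = pi"
  proof -
    have "complex_of_real (b * a * cos (pi * x)) = of_real pi"
      using Gamma_half_reflection[of "complex_of_real x"] x
      by (simp add: a_def b_def flip: Gamma_complex_of_real cos_of_real)
    thus ?thesis by (simp only: of_real_eq_iff mult_ac)
  qed
  have "rGamma (1 + x) = 1 / c"
    by (simp add: c_def rGamma_inverse_Gamma divide_inverse)
  \<comment> \<open>With the entire function \<open>rGamma\<close>, x rGamma(1 + x) = rGamma(x) also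
    holds at x = 0, so no case split arises.\<close>
  have "x * rGamma (1 + x) * rGamma (1 - x) = sin (pi * x) / pi"
  proof -
    have "complex_of_real (x * rGamma (1 + x) * rGamma (1 - x)) = of_real (sin (pi * x) / pi)"
      using rGamma_reflection_complex[of "complex_of_real x"] rGamma_plus1[of "complex_of_real x"]
      by (simp add: add_ac flip: rGamma_complex_of_real sin_of_real)
    thus ?thesis by (simp only: of_real_eq_iff)
  qed
  hence c: "x * rGamma (1 - x) = c * sin (pi * x) / pi"
    using pos \<open>rGamma (1 + x) = 1 / c\<close> by (simp add: field_simps)
  have bc: "b * c * exp (2 * ln 2 * x) = sqrt pi * d"
  proof -
    have "1/2 + complex_of_real x \<notin> \<int>\<^sub>\<le>\<^sub>0"
      using x by (intro half_plus_notin_nonpos_Ints) auto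
    moreover have "1/2 + complex_of_real x + 1/2 \<notin> \<int>\<^sub>\<le>\<^sub>0"
    proof
      assume "1/2 + complex_of_real x + 1/2 \<in> \<int>\<^sub>\<le>\<^sub>0"
      then obtain n where "1/2 + complex_of_real x + 1/2 = - of_nat n" by (auto elim!: nonpos_Ints_cases')
      hence "Re (1/2 + complex_of_real x + 1/2) \<le> 0" by simp
      with x show False by simp
    qed
    ultimately have "Gamma (1/2 + complex_of_real x) * Gamma (1/2 + complex_of_real x + 1/2) =
        exp ((1 - 2 * (1/2 + complex_of_real x)) * of_real (ln 2)) * of_real (sqrt pi) * Gamma (2 * (1/2 + complex_of_real x))"
      by (rule Gamma_legendre_duplication)
    also have "1/2 + complex_of_real x + 1/2 = of_real (1 + x)" by simp
    also have "2 * (1/2 + complex_of_real x) = of_real (1 + 2 * x)" by simp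
    also have "1/2 + complex_of_real x = of_real (1/2 + x)" by simp
    also have "(1 - complex_of_real (1 + 2 * x)) * of_real (ln 2) = of_real (- (2 * ln 2 * x))" by simp
    finally have "complex_of_real (b * c) = of_real (exp (- (2 * ln 2 * x)) * sqrt pi * d)"
      unfolding Gamma_complex_of_real exp_of_real b_def c_def d_def by (simp only: of_real_mult)
    hence "b * c = exp (- (2 * ln 2 * x)) * sqrt pi * d"
      by (simp only: of_real_eq_iff)
    thus ?thesis by (simp add: exp_minus field_simps)
  qed
  have cos: "cos (pi * x) \<noteq> 0" using ab by auto
  \<comment> \<open>Here Gamma(1/2) = sqrt(pi), and the two Beta arguments add up to 1 - x.\<close>
  have "x * Beta (1/2 - x) (1/2) = a * sqrt pi * (x * rGamma (1 - x))"
    by (simp add: Beta_altdef a_def Gamma_one_half_real)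
  also have "\<dots> = sqrt pi * (a * b * cos (pi * x)) * c * tan (pi * x) / (pi * b)"
    using pos cos by (simp add: c tan_def)
  also have "\<dots> = c * tan (pi * x) * (sqrt pi * d) / (b * d)"
    using pos by (simp add: ab)
  also have "\<dots> = tan (pi * x) * c\<^sup>2 * exp (2 * ln 2 * x) / d"
    unfolding bc[symmetric] using pos by (simp add: power2_eq_square)
  finally show ?thesis unfolding c_def d_def .
qed

definition rGamma_double_fps :: "real fps" where
  "rGamma_double_fps = Abs_fps (\<lambda>n. 2 ^ n * rGamma_fps $ n)"

text \<open>Both sides times \<open>fps_X\<close> expand x B(1/2 - x, 1/2), so uniqueness applies
  and \<open>fps_X\<close> cancels. The constant 2/pi offsets the pi/2 in
  \<open>tan_expansion\<close>.\<close>

lemma binom_fps_eq: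
  "binom_fps = fps_const (2 / pi) * (Gamma_fps * (Gamma_fps * (rGamma_double_fps * (fps_exp (2 * ln 2) * t_tilde_fps))))"
proof -
  have "(\<lambda>x. x * Beta (1/2 - x) (1/2)) has_fps_expansion fps_X * binom_fps"
    by (intro fps_expansion_intros binom_expansion)
  moreover have "(\<lambda>x. x * Beta (1/2 - x) (1/2)) has_fps_expansion 
     fps_const (2 / pi) * (Gamma_fps * (Gamma_fps * (rGamma_double_fps * (fps_exp (2 * ln 2) * (fps_X * t_tilde_fps)))))"
  proof -
    define f where "f = (\<lambda>x::real. (2 / pi) * (Gamma (1 + x) * exp (euler_mascheroni * x) * 
       (Gamma (1 + x) * exp (euler_mascheroni * x) *
       (1 / (Gamma (1 + 2 * x) * exp (euler_mascheroni * (2 * x))) *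
       (exp (2 * ln 2 * x) * (pi * tan (pi * x) / 2))))))"
    have *: "f has_fps_expansion 
       fps_const (2 / pi) * (Gamma_fps * (Gamma_fps * (rGamma_double_fps * (fps_exp (2 * ln 2) * (fps_X * t_tilde_fps)))))"
      unfolding f_def rGamma_double_fps_def
      by (intro fps_expansion_intros Gamma_expansion tan_expansion
            has_fps_expansion_scale[OF rGamma_expansion])
    have "eventually (\<lambda>x. x \<in> ball 0 (1/2)) (nhds (0::real))"
      by (intro eventually_nhds_in_open) auto
    hence "eventually (\<lambda>x. f x = x * Beta (1/2 - x) (1/2)) (nhds 0)"
    proof eventually_elim
      case (elim x)
      hence x: "\<bar>x\<bar> < 1/2" by simp
      \<comment> \<open>The two factors e^(gamma x) from \<open>Gamma_fps\<close> cancel against the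
        one from the reciprocal at 2x.\<close>
      have "exp (euler_mascheroni * (2 * x)) = (exp (euler_mascheroni * x))\<^sup>2"
        by (simp add: exp_double[symmetric] mult_ac)
      moreover have "Gamma (1 + 2 * x) > 0"
        using x by (intro Gamma_real_pos) auto
      ultimately show ?case
        unfolding f_def Beta_half_eq_tan[OF x] by (simp add: field_simps power2_eq_square)
    qed
    from has_fps_expansion_cong[OF this refl] * show ?thesis by simp
  qed
  ultimately have "fps_X * binom_fps = 
    fps_const (2 / pi) * (Gamma_fps * (Gamma_fps * (rGamma_double_fps * (fps_exp (2 * ln 2) * (fps_X * t_tilde_fps)))))"
    by (rule has_fps_expansion_unique)
  also have "\<dots> = fps_X * (fps_const (2 / pi) * (Gamma_fps * (Gamma_fps * (rGamma_double_fps * (fps_exp (2 * ln 2) * t_tilde_fps)))))"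
    by (simp only: mult_ac)
  finally show ?thesis by (simp only: mult_cancel_left fps_X_neq_zero simp_thms) 
qed

lemma fps_mult5_nth_even:
  fixes f1 f2 f3 f4 g :: "'a :: comm_semiring_1 fps"
  assumes odd: "\<And>n. odd n \<Longrightarrow> g $ n = 0"
  shows "(f1 * (f2 * (f3 * (f4 * g)))) $ m =
    (\<Sum>(k1, k2, k3, k4, k5) \<in> indices m. f1 $ k1 * (f2 $ k2 * (f3 $ k3 * (f4 $ k4 * g $ (2 * k5)))))"
proof -
  \<comment> \<open>\<open>A\<close> indexes the nested convolution, the last index being the
    remainder. \<open>B\<close> keeps the even remainders 2 k5; the others contribute 0 by
    \<open>odd\<close>.\<close>
  define A where "A = (SIGMA k1:{0..m}. SIGMA k2:{0..m-k1}. SIGMA k3:{0..m-k1-k2}. {0..m-k1-k2-k3})"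
  define B where "B = {(k1, k2, k3, k4). \<exists>k5. k1 + k2 + k3 + k4 + 2 * k5 = m}"
  define F where "F = (\<lambda>(k1,k2,k3,k4). f1 $ k1 * (f2 $ k2 * (f3 $ k3 * (f4 $ k4 * g $ (m-k1-k2-k3-k4)))))"
  have "(f1 * (f2 * (f3 * (f4 * g)))) $ m = sum F A"
    unfolding A_def F_def fps_mult_nth sum_distrib_left
    by (simp add: sum.Sigma case_prod_unfold)
  also have "\<dots> = sum F B"
  proof (rule sum.mono_neutral_right)
    show "B \<subseteq> A" by (auto simp: A_def B_def)
    show "finite A" by (simp add: A_def)
    show "\<forall>p\<in>A - B. F p = 0"
    proof (safe)
      fix k1 k2 k3 k4
      assume in_A: "(k1, k2, k3, k4) \<in> A" and not_B: "(k1, k2, k3, k4) \<notin> B"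
      have "odd (m-k1-k2-k3-k4)"
      proof
        assume "even (m-k1-k2-k3-k4)"
        then obtain k5 where "m-k1-k2-k3-k4 = 2 * k5" by (rule evenE)
        hence "k1 + k2 + k3 + k4 + 2 * k5 = m" using in_A by (simp add: A_def) linarith
        with not_B show False by (auto simp: B_def)
      qed
      from odd[OF this] show "F (k1, k2, k3, k4) = 0" by (simp only: F_def prod.case mult_zero_right)
    qed
  qed
  also have "\<dots> = (\<Sum>(k1, k2, k3, k4, k5) \<in> indices m. f1 $ k1 * (f2 $ k2 * (f3 $ k3 * (f4 $ k4 * g $ (2 * k5)))))"
  proof -
    \<comment> \<open>Forgetting k5 is injective on \<open>indices m\<close>, since the sum
      condition determines it.\<close>
    define p where "p = (\<lambda>(k1 :: nat, k2 :: nat, k3 :: nat, k4 :: nat, k5 :: nat). (k1, k2, k3, k4))"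
    have p [simp]: "p (k1, k2, k3, k4, k5) = (k1, k2, k3, k4)" for k1 k2 k3 k4 k5
      by (simp add: p_def)
    have "inj_on p (indices m)"
      by (auto simp: inj_on_def indices_def)
    moreover have "p ` indices m = B"
    proof (intro equalityI subsetI)
      fix x assume "x \<in> B"
      then obtain k1 k2 k3 k4 k5 where x: "x = (k1, k2, k3, k4)" "k1 + k2 + k3 + k4 + 2 * k5 = m"
        by (auto simp: B_def)
      hence "(k1, k2, k3, k4, k5) \<in> indices m" by (simp add: indices_def)
      thus "x \<in> p ` indices m" using x(1) p by (metis image_eqI)
    qed (auto simp: indices_def B_def)
    ultimately have "sum F B = sum (F \<circ> p) (indices m)"
      by (metis sum.reindex)
    also have "\<dots> = (\<Sum>(k1, k2, k3, k4, k5) \<in> indices m. f1 $ k1 * (f2 $ k2 * (f3 $ k3 * (f4 $ k4 * g $ (2 * k5)))))"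
    proof (rule sum.cong)
      fix x assume "x \<in> indices m"
      then obtain k1 k2 k3 k4 k5 where x: "x = (k1, k2, k3, k4, k5)" "m = k1 + k2 + k3 + k4 + 2 * k5"
        by (auto simp: indices_def)
      have "m - k1 - k2 - k3 - k4 = 2 * k5" using x(2) by simp
      with x(1) show "(F \<circ> p) x = (case x of (k1, k2, k3, k4, k5) \<Rightarrow> f1 $ k1 * (f2 $ k2 * (f3 $ k3 * (f4 $ k4 * g $ (2 * k5)))))"
        by (simp only: F_def comp_apply p prod.case)
    qed simp
    finally show ?thesis .
  qed
  finally show ?thesis .
qed

section \<open>The left-hand summand and the conclusion\<close>

lemma central_binomial_eq_half_binom: "real ((2 * n) choose n) / 4 ^ n = half_binom n"
proof -
  have "real ((2 * n) choose n) = fact (2 * n) / (fact n * fact n)"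
    using binomial_fact[of n "2 * n", where 'a = real] by simp
  also have "fact (2 * n) = 4 ^ n * pochhammer (1/2) n * (fact n :: real)"
    using fact_double[of n, where 'a = real] by (simp only: power_mult power2_eq_square) simp
  finally show ?thesis by (simp add: half_binom_def)
qed

lemma summand_eq_half_binom:
  assumes "q > 1"
  shows "real (Suc n) / (real (Suc n) - 1 / 2) ^ q * (real ((2 * Suc n) choose (Suc n)) / 4 ^ Suc n) =
         half_binom n / (real n + 1/2) ^ Suc (q - 2)"
proof -
  have "real ((2 * Suc n) choose (Suc n)) / 4 ^ Suc n = half_binom (Suc n)"
    by (rule central_binomial_eq_half_binom)
  \<comment> \<open>This ratio cancels the numerator n + 1 and one power of n + 1/2, leaving
    exponent q - 1, written \<open>Suc (q - 2)\<close> as in \<open>binom_fps\<close>.\<close>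
  also have "half_binom (Suc n) = half_binom n * (real n + 1/2) / real (Suc n)"
    by (simp add: half_binom_def pochhammer_Suc field_simps del: of_nat_Suc)
  finally have "real ((2 * Suc n) choose (Suc n)) / 4 ^ Suc n = half_binom n * (real n + 1/2) / real (Suc n)" .
  moreover have "real (Suc n) - 1/2 = real n + 1/2" by simp
  ultimately have "real (Suc n) / (real (Suc n) - 1 / 2) ^ q * (real ((2 * Suc n) choose (Suc n)) / 4 ^ Suc n) =
      real (Suc n) / (real n + 1/2) ^ q * (half_binom n * (real n + 1/2) / real (Suc n))"
    by (simp only:)
  also have "\<dots> = half_binom n * (real n + 1/2) / (real n + 1/2) ^ q"
    by (simp del: of_nat_Suc)
  also have "(real n + 1/2) ^ q = (real n + 1/2) * (real n + 1/2) ^ Suc (q - 2)"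
    using assms by (simp only: power_Suc [symmetric]) (simp add: Suc_diff_Suc numeral_2_eq_2)
  also have "half_binom n * (real n + 1/2) / ((real n + 1/2) * (real n + 1/2) ^ Suc (q - 2)) =
      half_binom n / (real n + 1/2) ^ Suc (q - 2)"
    by simp
  finally show ?thesis .
qed

theorem theorem8p5:
  fixes q :: nat
  assumes "q > 1"
  shows "(\<lambda>n. real (Suc n) / (real (Suc n) - 1 / 2) ^ q
              * (real ((2 * Suc n) choose (Suc n)) / 4 ^ Suc n))
         sums (2 / pi * (\<Sum>(k1, k2, k3, k4, k5) \<in> indices (q - 2).
                 G k1 k2 k3 k4 * t_tilde (real (2 * k5 + 2))))"
proof -
  have "(\<lambda>n. half_binom n / (real n + 1/2) ^ Suc (q - 2)) sums (binom_fps $ (q - 2))"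
    using half_binom_summable by (simp add: binom_fps_def summable_sums)
  also have "binom_fps $ (q - 2) = 2 / pi * (\<Sum>(k1, k2, k3, k4, k5) \<in> indices (q - 2).
                 G k1 k2 k3 k4 * t_tilde (real (2 * k5 + 2)))"
    unfolding binom_fps_eq fps_mult_left_const_nth
  proof (subst fps_mult5_nth_even)
    show "t_tilde_fps $ n = 0" if "odd n" for n
      using that by (simp add: t_tilde_fps_def)
    \<comment> \<open>The power 2^(k3+k4) in \<open>G\<close> has two sources: 2^k3 from the
      argument 2x of the reciprocal Gamma, and 2^k4 from 4^x = e^(2 x ln 2).\<close>
    have "Gamma_fps $ k1 * (Gamma_fps $ k2 * (rGamma_double_fps $ k3 * (fps_exp (2 * ln 2) $ k4 * t_tilde_fps $ (2 * k5)))) =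
            G k1 k2 k3 k4 * t_tilde (real (2 * k5 + 2))" for k1 k2 k3 k4 k5
      by (simp add: G_def rGamma_double_fps_def t_tilde_fps_def fps_nth_Gamma_fps fps_nth_rGamma_fps
                    power_add power_mult_distrib mult_ac)
    thus "2 / pi * (\<Sum>(k1, k2, k3, k4, k5)\<in>indices (q - 2). Gamma_fps $ k1 * (Gamma_fps $ k2 *
             (rGamma_double_fps $ k3 * (fps_exp (2 * ln 2) $ k4 * t_tilde_fps $ (2 * k5))))) =
           2 / pi * (\<Sum>(k1, k2, k3, k4, k5)\<in>indices (q - 2). G k1 k2 k3 k4 * t_tilde (real (2 * k5 + 2)))"
      by (simp only:)
  qed
  finally show ?thesis
    by (simp only: summand_eq_half_binom[OF assms])
qed

end
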